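(* Let $s\geq 1$, $k\geq 1$ and $p\geq 1$ be integers, and let $n_1,\dots,n_p$ be positive integers with $n_i\geq sk+1$ for $i=1,\dots,p$. Put $N=\sum_{i=1}^p n_i$. Then the number of $s$-separated $k$-element subsets of $[n_1,\dots,n_p]$ is \[ \left|[n_1,\dots,n_p]_k^s\right| = \frac{N}{k}\binom{N-sk-1}{k-1}. \]
   Context: For positive integers $n_1,\dots,n_p$, let $[n]=\{1,\dots,n\}$ and $[n_1,\dots,n_p]=([n_1]\times\{1\})\cup\cdots\cup([n_p]\times\{p\})$; the elements with second coordinate $i$ are regarded as arranged in cyclic order $1,2,\dots,n_i$ around the $i$-th circle (so $n_i$ is followed by $1$). A subset of $[n_1,\dots,n_p]$ is $s$-separated if no two of its elements lie in the same circle with fewer than $s$ elements of that circle between them; i.e. for any two distinct elements $(a,i),(b,i)$ of the set in the same circle of size $n_i$, both $|a-b|-1\geq s$ and $n_i-|a-b|-1\geq s$. Elements in different circles impose no restriction. $[n_1,\dots,n_p]_k^s$ denotes the set of $s$-separated $k$-element subsets of $[n_1,\dots,n_p]$. *)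

theory Defs
  imports Complex_Main
begin

definition circles :: "nat \<Rightarrow> (nat \<Rightarrow> nat) \<Rightarrow> (nat \<times> nat) set" where
  "circles p n = (\<Union>i\<in>{1..p}. {1..n i} \<times> {i})"

text \<open>The two arcs between the points \<open>a\<close> and \<open>b\<close> of the \<open>i\<close>-th circle contain
  \<open>\<bar>a - b\<bar> - 1\<close> and \<open>n i - \<bar>a - b\<bar> - 1\<close> points; integers avoid truncated subtraction.\<close>

definition separated :: "(nat \<Rightarrow> nat) \<Rightarrow> nat \<Rightarrow> (nat \<times> nat) set \<Rightarrow> bool" where
  "separated n s A \<longleftrightarrow>
     (\<forall>a b i. (a, i) \<in> A \<and> (b, i) \<in> A \<and> a \<noteq> b \<longrightarrow>
        \<bar>int a - int b\<bar> - 1 \<ge> int s \<and> int (n i) - \<bar>int a - int b\<bar> - 1 \<ge> int s)"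

definition separated_subsets :: "nat \<Rightarrow> (nat \<Rightarrow> nat) \<Rightarrow> nat \<Rightarrow> nat \<Rightarrow> (nat \<times> nat) set set" where
  "separated_subsets p n s k = {A. A \<subseteq> circles p n \<and> card A = k \<and> separated n s A}"

end

theory Submission
  imports Defs
begin

text \<open>On a single circle of size \<open>n \<ge> s k + 1\<close>, the separated sets that avoid the points
  \<open>1, \<dots>, s\<close> are the separated sets of a path, and those that meet these points do so in exactly
  one point \<open>i\<close>, the rest being a separated set of a path of \<open>n - 2 s - 1\<close> points; this gives
  the formula for \<open>p = 1\<close>. The right-hand side, as a polynomial \<open>R\<^sub>k(N)\<close>, satisfies
  \<open>R\<^sub>k(x + 1) = R\<^sub>k(x) + R\<^sub>k\<^sub>-\<^sub>1(x - s)\<close>, and from this the Rothe--Hagen convolution identity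
  \<open>\<Sum>\<^sub>j R\<^sub>j(x) R\<^sub>k\<^sub>-\<^sub>j(y) = R\<^sub>k(x + y)\<close> follows by induction, starting from \<open>x = 0\<close>. Several
  circles are handled by adding one circle at a time.\<close>

section \<open>Rothe polynomials: recurrence and convolution\<close>

definition rothe :: "nat \<Rightarrow> nat \<Rightarrow> real \<Rightarrow> real" where
  "rothe s k x = (if k = 0 then 1 else x / real k * ((x - real (s * k) - 1) gchoose (k - 1)))"

lemma rothe_0 [simp]: "rothe s 0 x = 1"
  by (simp add: rothe_def)

text \<open>At 0 the family is the neutral element for convolution; this starts both the induction
  on \<open>x\<close> in the convolution and the induction on the number of circles.\<close>

lemma rothe_at_0: "rothe s k 0 = (if k = 0 then 1 else 0)"
  by (simp add: rothe_def)

text \<open>Pascal's rule splits the binomial on the left, and the shift by \<open>s\<close> gives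
  the last term the same upper entry \<open>y\<close>. Absorption expresses everything through
  \<open>c\<close>, leaving a rational identity. The case \<open>k = 0\<close> is separate because
  \<open>rothe s 0\<close> is set to 1 by convention.\<close>

lemma rothe_rec: "rothe s (Suc k) (x + 1) = rothe s (Suc k) x + rothe s k (x - real s)"
proof (cases k)
  case 0
  then show ?thesis by (simp add: rothe_def)
next
  case (Suc m)
  define y where "y = x - real s * (real k + 1) - 1"
  define c where "c = y gchoose m"
  have pascal: "(y + 1) gchoose k = c + (y gchoose k)"
    unfolding c_def Suc by (rule gbinomial_Suc_Suc)
  have absorb: "real k * (y gchoose k) = (y - real m) * c"
    using gbinomial_absorb_comp[of y m] gbinomial_absorption[of m y] by (simp add: c_def Suc)
  have k: "real k > 0" "real k = real m + 1" by (simp_all add: Suc)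
  have "rothe s (Suc k) (x + 1) = (x + 1) / (real k + 1) * (c + (y gchoose k))"
    unfolding rothe_def pascal[symmetric] by (simp add: y_def algebra_simps)
  moreover have "rothe s (Suc k) x = x / (real k + 1) * (y gchoose k)"
    unfolding rothe_def by (simp add: y_def algebra_simps)
  moreover have "rothe s k (x - real s) = (x - real s) / real k * c"
    unfolding rothe_def by (simp add: y_def c_def Suc algebra_simps)
  moreover have "y gchoose k = (y - real m) * c / real k"
    using absorb k(1) by (simp add: field_simps)
  moreover have "(x + 1) / (real k + 1) * (c + (y - real m) * c / real k) =
      x / (real k + 1) * ((y - real m) * c / real k) + (x - real s) / real k * c"
    using k by (simp add: divide_simps y_def) (simp add: algebra_simps)
  ultimately show ?thesis by simp
qed

text \<open>The variable \<open>x\<close> ranges over the integers because the step from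
  \<open>k\<close> to \<open>Suc k\<close> uses the identity for \<open>k\<close> at
  \<open>x - int s\<close>, which may be negative.\<close>

lemma rothe_convolution:
  fixes x :: int and y :: real
  shows "(\<Sum>j\<le>k. rothe s j (of_int x) * rothe s (k - j) y) = rothe s k (of_int x + y)"
proof (induction k arbitrary: x)
  case 0
  then show ?case by simp
next
  case (Suc k)
  \<comment> \<open>The defect of the identity: it is invariant under unit steps and vanishes at 0,
    hence at every integer.\<close>
  define D where "D x = (\<Sum>j\<le>Suc k. rothe s j (of_int x) * rothe s (Suc k - j) y)
    - rothe s (Suc k) (of_int x + y)" for x :: int
  have step: "D (x + 1) = D x" for x
  proof -
    \<comment> \<open>The term \<open>j = 0\<close> does not depend on \<open>x\<close>; in the
      others the recurrence adds a convolution sum of total degree \<open>k\<close>.\<close>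
    have "(\<Sum>j\<le>Suc k. rothe s j (of_int (x + 1)) * rothe s (Suc k - j) y) =
        (\<Sum>j\<le>Suc k. rothe s j (of_int x) * rothe s (Suc k - j) y)
        + (\<Sum>j\<le>k. rothe s j (of_int (x - int s)) * rothe s (k - j) y)"
      by (simp add: sum.atMost_Suc_shift rothe_rec distrib_right sum.distrib del: sum.atMost_Suc)
    then show ?thesis
      using rothe_rec[of s k "of_int x + y"] Suc.IH[of "x - int s"]
      by (simp add: D_def algebra_simps del: sum.atMost_Suc)
  qed
  have "D x = 0"
  proof (induction x rule: int_induct[of _ 0])
    case base
    then show ?case
      by (simp add: D_def sum.atMost_Suc_shift rothe_at_0 del: sum.atMost_Suc)
  next
    case (step1 i)
    then show ?case by (simp add: step)
  next
    case (step2 i)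
    then show ?case using step[of "i - 1"] by simp
  qed
  then show ?case by (simp add: D_def)
qed

section \<open>Separated sets on a path of \<open>m\<close> points starting after the offset
  \<open>u\<close>\<close>

definition line_sets :: "nat \<Rightarrow> nat \<Rightarrow> nat \<Rightarrow> nat \<Rightarrow> nat set set" where
  "line_sets s u m k =
    {A. A \<subseteq> {u<..u+m} \<and> card A = k \<and> (\<forall>a\<in>A. \<forall>b\<in>A. a < b \<longrightarrow> a + s < b)}"

lemma finite_line_sets [simp]: "finite (line_sets s u m k)"
  by (rule finite_subset[of _ "Pow {u<..u+m}"]) (auto simp: line_sets_def)

lemma finite_in_line_sets: "A \<in> line_sets s u m k \<Longrightarrow> finite A"
  by (auto simp: line_sets_def intro: finite_subset)

lemma card_image_insert:
  assumes "\<And>A. A \<in> X \<Longrightarrow> x \<notin> A"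
  shows "card (insert x ` X) = card X"
  by (rule card_image) (metis assms inj_onI insert_ident)

lemma line_sets_0 [simp]: "line_sets s u m 0 = {{}}"
  using finite_subset[of _ "{u<..u+m}"] by (auto simp: line_sets_def card_eq_0_iff)

text \<open>Case distinction on the last point of the path: choosing it forbids the \<open>s\<close>
  points before it. If \<open>m < s\<close>, the truncated \<open>m - s\<close> rightly leaves an
  empty path.\<close>

lemma line_sets_Suc_Suc:
  "line_sets s u (Suc m) (Suc k) =
    line_sets s u m (Suc k) \<union> insert (u + Suc m) ` line_sets s u (m - s) k"
proof (intro set_eqI iffI)
  fix A
  assume A: "A \<in> line_sets s u (Suc m) (Suc k)"
  show "A \<in> line_sets s u m (Suc k) \<union> insert (u + Suc m) ` line_sets s u (m - s) k"
  proof (cases "u + Suc m \<in> A")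
    case True
    let ?B = "A - {u + Suc m}"
    have "?B \<subseteq> {u<..u+(m-s)}"
    proof
      fix b assume b: "b \<in> ?B"
      then have "u < b" "b < u + Suc m"
        using A by (force simp: line_sets_def)+
      moreover from this have "b + s < u + Suc m"
        using A b True by (auto simp: line_sets_def)
      ultimately show "b \<in> {u<..u+(m-s)}" by auto
    qed
    moreover have "card ?B = k"
      using A True finite_in_line_sets[OF A] by (simp add: line_sets_def)
    ultimately have "?B \<in> line_sets s u (m - s) k"
      using A by (simp add: line_sets_def)
    then show ?thesis using True by (metis UnI2 image_eqI insert_Diff)
  next
    case False
    then have "A \<subseteq> {u<..u+m}"
      using A by (force simp: line_sets_def le_Suc_eq)
    then show ?thesis using A by (simp add: line_sets_def)
  qed
next
  fix A
  assume "A \<in> line_sets s u m (Suc k) \<union> insert (u + Suc m) ` line_sets s u (m - s) k"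
  then show "A \<in> line_sets s u (Suc m) (Suc k)"
  proof
    assume "A \<in> line_sets s u m (Suc k)"
    then show ?thesis by (force simp: line_sets_def)
  next
    assume "A \<in> insert (u + Suc m) ` line_sets s u (m - s) k"
    then obtain B where A: "A = insert (u + Suc m) B" and B: "B \<in> line_sets s u (m - s) k"
      by blast
    have bound: "u < b \<and> b + s < u + Suc m" if "b \<in> B" for b
      using B that by (force simp: line_sets_def)
    then have "u + Suc m \<notin> B" by force
    then have "card A = Suc k"
      using A B finite_in_line_sets[OF B] by (simp add: line_sets_def)
    moreover have "A \<subseteq> {u<..u+Suc m}"
      using bound A by force
    moreover have "\<forall>a\<in>A. \<forall>b\<in>A. a < b \<longrightarrow> a + s < b"
      using bound A B by (fastforce simp: line_sets_def)
    ultimately show ?thesis by (simp add: line_sets_def)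
  qed
qed

text \<open>Pascal's rule matches the recursion on the last point. Adding \<open>s\<close> before
  subtracting \<open>s * k\<close> keeps the formula correct for every \<open>m\<close> and
  \<open>k\<close>, since truncation to 0 occurs only where the count is 0 or
  \<open>k = 0\<close>.\<close>

lemma card_line_sets: "card (line_sets s u m k) = (m + s - s * k) choose k"
proof (induction m arbitrary: k rule: less_induct)
  case (less m)
  show ?case
  proof (cases k)
    case 0
    then show ?thesis by simp
  next
    case k: (Suc j)
    show ?thesis
    proof (cases m)
      case 0
      then have "line_sets s u m k = {}" by (auto simp: line_sets_def k)
      then show ?thesis using 0 k by simp
    next
      case m: (Suc l)
      have "line_sets s u l (Suc j) \<inter> insert (u + Suc l) ` line_sets s u (l - s) j = {}"
        by (auto simp: line_sets_def)
      then have "card (line_sets s u m k) =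
          card (line_sets s u l (Suc j)) + card (insert (u + Suc l) ` line_sets s u (l - s) j)"
        unfolding m k line_sets_Suc_Suc by (intro card_Un_disjoint) auto
      also have "card (insert (u + Suc l) ` line_sets s u (l - s) j) = card (line_sets s u (l - s) j)"
        by (rule card_image_insert) (auto simp: line_sets_def)
      also have "card (line_sets s u l (Suc j)) = (l - s * j) choose Suc j"
        using less[of l "Suc j"] m by simp
      also have "card (line_sets s u (l - s) j) = (l - s + s - s * j) choose j"
        using less[of "l - s" j] m by simp
      also have "(l - s + s - s * j) choose j = (l - s * j) choose j"
      \<comment> \<open>For \<open>l < s\<close> the term \<open>l - s + s\<close> is
        \<open>s\<close>, not \<open>l\<close>; but if also \<open>j > 0\<close>, both upper entries
        are truncated to 0.\<close>
      proof (cases "j = 0 \<or> s \<le> l")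
        case False
        then have "l < s * j" using less_le_trans[of l s "s * j"] by simp
        then show ?thesis using False by simp
      qed auto
      also have "(l - s * j choose Suc j) + (l - s * j choose j) = (m + s - s * k) choose k"
      \<comment> \<open>Pascal's rule needs an exact difference. Otherwise all upper entries are 0
        while all lower entries are positive.\<close>
      proof (cases "s * j \<le> l")
        case True
        then have "m + s - s * k = Suc (l - s * j)" by (simp add: m k)
        then show ?thesis by (simp add: k)
      next
        case False
        then have "j \<noteq> 0" by (cases j) auto
        then show ?thesis using False by (simp add: m k)
      qed
      finally show ?thesis .
    qed
  qed
qed

section \<open>Separated sets on one circle\<close>

definition circle_sets :: "nat \<Rightarrow> nat \<Rightarrow> nat \<Rightarrow> nat set set" where
  "circle_sets s n k = {A. A \<subseteq> {1..n} \<and> card A = k \<and>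
    (\<forall>a\<in>A. \<forall>b\<in>A. a < b \<longrightarrow> a + s < b \<and> b + s < a + n)}"

lemma finite_circle_sets [simp]: "finite (circle_sets s n k)"
  by (rule finite_subset[of _ "Pow {1..n}"]) (auto simp: circle_sets_def)

lemma circle_sets_0 [simp]: "circle_sets s n 0 = {{}}"
  using finite_subset[of _ "{1..n}"] by (auto simp: circle_sets_def card_eq_0_iff)

lemma circle_sets_1: "circle_sets s n (Suc 0) = (\<lambda>a. {a}) ` {1..n}"
  by (auto simp: circle_sets_def card_1_singleton_iff)

text \<open>If \<open>1, ..., s\<close> are avoided, the arc through \<open>n\<close> and 1 between
  any two points is long enough, so only the path condition remains. A chosen \<open>i\<close> in
  that range restricts the others to \<open>i + s + 1, ..., i + n - s - 1\<close>; as
  \<open>i \<le> s\<close>, this stays below \<open>n\<close> and does not wrap around.\<close>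

lemma circle_sets_split:
  assumes n: "2 * s + 1 \<le> n"
  shows "circle_sets s n (Suc k) = line_sets s s (n - s) (Suc k) \<union>
    (\<Union>i\<in>{1..s}. insert i ` line_sets s (i + s) (n - 2 * s - 1) k)"
    (is "_ = ?L \<union> ?R")
proof (intro set_eqI iffI)
  fix A
  assume A: "A \<in> circle_sets s n (Suc k)"
  then have fin: "finite A"
    by (auto simp: circle_sets_def intro: finite_subset)
  show "A \<in> ?L \<union> ?R"
  proof (cases "\<exists>i\<in>{1..s}. i \<in> A")
    case True
    then obtain i where i: "1 \<le> i" "i \<le> s" "i \<in> A" by auto
    let ?B = "A - {i}"
    have "?B \<subseteq> {i+s<..i+s+(n-2*s-1)}"
    proof
      fix b assume b: "b \<in> ?B"
      \<comment> \<open>Otherwise \<open>b + s < i\<close>, against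
        \<open>i \<le> s\<close>.\<close>
      have "\<not> b < i"
        using A b i by (force simp: circle_sets_def)
      then have "i < b" using b by auto
      then have "i + s < b" "b + s < i + n"
        using A b i by (auto simp: circle_sets_def)
      then show "b \<in> {i+s<..i+s+(n-2*s-1)}" using n by auto
    qed
    moreover have "card ?B = k"
      using A i fin by (simp add: circle_sets_def)
    ultimately have "?B \<in> line_sets s (i + s) (n - 2 * s - 1) k"
      using A by (simp add: line_sets_def circle_sets_def)
    moreover have "A = insert i ?B" using i by auto
    ultimately have "A \<in> insert i ` line_sets s (i + s) (n - 2 * s - 1) k"
      by (rule rev_image_eqI)
    then show ?thesis using i(1,2) by (intro UnI2 UN_I[of i]) auto
  next
    case False
    then have "A \<subseteq> {s<..s+(n-s)}"
      using A n by (force simp: circle_sets_def not_le)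
    then show ?thesis using A by (simp add: circle_sets_def line_sets_def)
  qed
next
  fix A
  assume "A \<in> ?L \<union> ?R"
  then show "A \<in> circle_sets s n (Suc k)"
  proof
    assume A: "A \<in> ?L"
    then have bound: "s < a \<and> a \<le> n" if "a \<in> A" for a
      using that n by (force simp: line_sets_def)
    have "b + s < a + n" if "a \<in> A" "b \<in> A" for a b
      using bound[OF that(1)] bound[OF that(2)] by linarith
    moreover have "A \<subseteq> {1..n}" using bound by force
    ultimately show ?thesis using A by (simp add: circle_sets_def line_sets_def)
  next
    assume "A \<in> ?R"
    then obtain i B where i: "1 \<le> i" "i \<le> s" and A: "A = insert i B"
      and B: "B \<in> line_sets s (i + s) (n - 2 * s - 1) k" by auto
    have bound: "i + s < b \<and> b + s < i + n" if "b \<in> B" for b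
      using B that n by (force simp: line_sets_def)
    then have "i \<notin> B" by force
    then have "card A = Suc k"
      using A B finite_in_line_sets[OF B] by (simp add: line_sets_def)
    moreover have "A \<subseteq> {1..n}"
      using bound A i n by fastforce
    moreover have "a + s < b \<and> b + s < a + n" if "a \<in> A" "b \<in> A" "a < b" for a b
    proof -
      have "b \<in> B" using that A bound by force
      moreover have "a = i \<or> a \<in> B" using that A by auto
      moreover have "a \<in> B \<Longrightarrow> b \<in> B \<Longrightarrow> a + s < b"
        using B that by (simp add: line_sets_def)
      ultimately show ?thesis using bound[of a] bound[of b] by auto
    qed
    ultimately show ?thesis by (simp add: circle_sets_def)
  qed
qed

text \<open>The split needs \<open>2 * s + 1 \<le> n\<close>, which the hypothesis supplies only for
  \<open>k \<ge> 2\<close>; smaller \<open>k\<close> are counted directly. After multiplication by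
  \<open>k\<close>, absorption gives the factor \<open>t + 1 + s * k = n\<close>.\<close>

lemma card_circle_sets:
  assumes n: "s * k + 1 \<le> n"
  shows "real (card (circle_sets s n k)) = rothe s k (real n)"
proof -
  consider "k = 0" | "k = 1" | j where "k = Suc (Suc j)"
    by (metis One_nat_def not0_implies_Suc)
  then show ?thesis
  proof cases
    case 1
    then show ?thesis by simp
  next
    case 2
    then show ?thesis by (simp add: circle_sets_1 card_image rothe_def)
  next
    case (3 j)
    \<comment> \<open>The upper entry of the binomial in \<open>rothe s k (real n)\<close>.\<close>
    define t where "t = n - s * k - 1"
    have t: "n = t + s * k + 1" using n by (simp add: t_def)
    let ?L = "line_sets s s (n - s) k"
    let ?R = "\<lambda>i. insert i ` line_sets s (i + s) (n - 2 * s - 1) (Suc j)"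
    have ns: "2 * s + 1 \<le> n" using n by (simp add: 3)
    have "?L \<inter> (\<Union>i\<in>{1..s}. ?R i) = {}"
      by (auto simp: line_sets_def)
    then have "card (circle_sets s n k) = card ?L + card (\<Union>i\<in>{1..s}. ?R i)"
      unfolding 3 circle_sets_split[OF ns] by (intro card_Un_disjoint) auto
    also have "card (\<Union>i\<in>{1..s}. ?R i) = (\<Sum>i\<in>{1..s}. card (?R i))"
    proof (intro card_UN_disjoint ballI impI)
      fix i i' assume "i \<in> {1..s}" "i' \<in> {1..s}" "i \<noteq> i'"
      \<comment> \<open>A set in \<open>?R i'\<close> has \<open>i'\<close> as its only point up to
        \<open>s\<close>, so the families are disjoint.\<close>
      moreover have "i = i'" if A: "A \<in> ?R i" "A \<in> ?R i'" "i \<le> s" "i' \<le> s" for A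
      proof -
        obtain B where "A = insert i' B" "B \<subseteq> {i'+s<..}"
          using A(2) by (fastforce simp: line_sets_def)
        then have "i = i' \<or> i' + s < i" using A(1) by auto
        then show ?thesis using A(3,4) by auto
      qed
      ultimately show "?R i \<inter> ?R i' = {}" by (meson atLeastAtMost_iff disjoint_iff)
    qed auto
    also have "\<dots> = (\<Sum>i\<in>{1..s}. (t choose Suc j))"
    proof (rule sum.cong[OF refl])
      fix i
      have "card (?R i) = card (line_sets s (i + s) (n - 2 * s - 1) (Suc j))"
        by (rule card_image_insert) (auto simp: line_sets_def)
      also have "\<dots> = t choose Suc j"
        unfolding card_line_sets by (simp add: t 3)
      finally show "card (?R i) = t choose Suc j" .
    qed
    also have "card ?L = Suc t choose k"
      unfolding card_line_sets by (simp add: t 3)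
    finally have "card (circle_sets s n k) = (Suc t choose k) + s * (t choose Suc j)"
      by simp
    moreover have "real k * real (Suc t choose k) = (real t + 1) * real (t choose Suc j)"
      using Suc_times_binomial_eq[of t "Suc j"]
      unfolding 3 by (metis of_nat_Suc of_nat_mult mult.commute add.commute)
    moreover have "real k * rothe s k (real n) = real n * real (t choose Suc j)"
      by (simp add: rothe_def t 3 binomial_gbinomial)
    moreover have "real n = real t + real s * real k + 1" by (simp add: t)
    ultimately have "real k * real (card (circle_sets s n k)) = real k * rothe s k (real n)"
      by (simp add: algebra_simps)
    then show ?thesis by (simp add: 3)
  qed
qed

section \<open>Several circles, added one at a time\<close>

lemma circles_Suc: "circles (Suc p) n = circles p n \<union> {1..n (Suc p)} \<times> {Suc p}"
  by (auto simp: circles_def le_Suc_eq)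

lemma finite_circles [simp]: "finite (circles p n)"
  by (simp add: circles_def)

lemma finite_separated_subsets [simp]: "finite (separated_subsets p n s k)"
  by (rule finite_subset[of _ "Pow (circles p n)"]) (auto simp: separated_subsets_def)

lemma not_in_circles_Suc: "(a, Suc p) \<notin> circles p n"
  by (auto simp: circles_def)

text \<open>Points on different circles do not interact. On the new circle, ordering each pair turns
  the absolute values into the form used in \<open>circle_sets\<close>.\<close>

lemma separated_Un_circle:
  assumes "A \<subseteq> circles p n"
  shows "separated n s (A \<union> B \<times> {Suc p}) \<longleftrightarrow> separated n s A \<and>
    (\<forall>a\<in>B. \<forall>b\<in>B. a < b \<longrightarrow> a + s < b \<and> b + s < a + n (Suc p))"
    (is "?S \<longleftrightarrow> _ \<and> ?C")
proof
  assume S: ?S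
  then have "separated n s A" by (auto simp: separated_def)
  moreover have "a + s < b \<and> b + s < a + n (Suc p)" if "a \<in> B" "b \<in> B" "a < b" for a b
    using S[unfolded separated_def, rule_format, of a "Suc p" b] that by auto
  ultimately show "separated n s A \<and> ?C" by blast
next
  assume *: "separated n s A \<and> ?C"
  show ?S
    unfolding separated_def
  proof (intro allI impI)
    fix a b i
    assume ab: "(a, i) \<in> A \<union> B \<times> {Suc p} \<and> (b, i) \<in> A \<union> B \<times> {Suc p} \<and> a \<noteq> b"
    show "\<bar>int a - int b\<bar> - 1 \<ge> int s \<and> int (n i) - \<bar>int a - int b\<bar> - 1 \<ge> int s"
    proof (cases "i = Suc p")
      case True
      then have "a \<in> B" "b \<in> B" using ab assms not_in_circles_Suc by auto
      then have "a < b \<longrightarrow> a + s < b \<and> b + s < a + n (Suc p)"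
        "b < a \<longrightarrow> b + s < a \<and> a + s < b + n (Suc p)" using * by auto
      moreover have "a < b \<or> b < a" using ab by linarith
      ultimately show ?thesis using True by auto
    next
      case False
      then show ?thesis using ab * by (auto simp: separated_def)
    qed
  qed
qed

text \<open>A set is cut into its part on the first \<open>p\<close> circles and its part on the
  last one; \<open>j\<close> counts the points of the former.\<close>

lemma card_separated_subsets_Suc:
  "card (separated_subsets (Suc p) n s k) =
    (\<Sum>j\<le>k. card (separated_subsets p n s j) * card (circle_sets s (n (Suc p)) (k - j)))"
proof -
  let ?P = "\<lambda>j. separated_subsets p n s j \<times> circle_sets s (n (Suc p)) (k - j)"
  let ?f = "\<lambda>(A, B). A \<union> B \<times> {Suc p}"
  have card_f: "card (A \<union> B \<times> {Suc p}) = card A + card B"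
    if "A \<subseteq> circles p n" "B \<subseteq> {1..n (Suc p)}" for A B
  proof -
    have "finite A" "finite B"
      using that by (auto intro: finite_subset[OF _ finite_circles] finite_subset)
    moreover have "A \<inter> B \<times> {Suc p} = {}" using that not_in_circles_Suc by fastforce
    ultimately show ?thesis by (simp add: card_Un_disjoint card_cartesian_product)
  qed
  have "bij_betw ?f (\<Union>j\<le>k. ?P j) (separated_subsets (Suc p) n s k)"
  proof (rule bij_betwI')
    fix X Y
    assume "X \<in> (\<Union>j\<le>k. ?P j)" "Y \<in> (\<Union>j\<le>k. ?P j)"
    then obtain A B A' B' where XY: "X = (A, B)" "Y = (A', B')"
      and sub: "A \<subseteq> circles p n" "A' \<subseteq> circles p n"
      by (auto simp: separated_subsets_def)
    \<comment> \<open>Both parts are recovered from the union, which gives injectivity.\<close>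
    have rec: "A = C - UNIV \<times> {Suc p}" "B = {b. (b, Suc p) \<in> C}"
      if "A \<subseteq> circles p n" "C = A \<union> B \<times> {Suc p}" for A B C
      using that not_in_circles_Suc by fastforce+
    show "(?f X = ?f Y) = (X = Y)"
      unfolding XY using rec[OF sub(1), of _ B] rec[OF sub(2), of _ B'] by auto
  next
    fix X
    assume "X \<in> (\<Union>j\<le>k. ?P j)"
    then obtain A B j where X: "X = (A, B)" "j \<le> k" and A: "A \<in> separated_subsets p n s j"
      and B: "B \<in> circle_sets s (n (Suc p)) (k - j)" by auto
    then have "A \<subseteq> circles p n" "B \<subseteq> {1..n (Suc p)}"
      by (auto simp: separated_subsets_def circle_sets_def)
    moreover from this have "?f X \<subseteq> circles (Suc p) n"
      by (auto simp: X circles_Suc)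
    ultimately show "?f X \<in> separated_subsets (Suc p) n s k"
      using A B X card_f[of A B]
      by (auto simp: separated_subsets_def circle_sets_def separated_Un_circle)
  next
    fix C
    assume C: "C \<in> separated_subsets (Suc p) n s k"
    define A where "A = C \<inter> circles p n"
    define B where "B = {b. (b, Suc p) \<in> C}"
    have sub: "A \<subseteq> circles p n" "B \<subseteq> {1..n (Suc p)}"
      using C not_in_circles_Suc by (auto simp: A_def B_def separated_subsets_def circles_Suc)
    have C_eq: "C = A \<union> B \<times> {Suc p}"
      using C not_in_circles_Suc by (auto simp: A_def B_def separated_subsets_def circles_Suc)
    then have "card A + card B = k"
      using card_f[OF sub] C by (simp add: separated_subsets_def)
    then have "card A \<le> k" "(A, B) \<in> ?P (card A)"
      using C sub separated_Un_circle[OF sub(1), of s B] C_eq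
      by (auto simp: separated_subsets_def circle_sets_def)
    then show "\<exists>X\<in>\<Union>j\<le>k. ?P j. C = ?f X"
      using C_eq by (intro bexI[of _ "(A, B)"]) auto
  qed
  then have "card (separated_subsets (Suc p) n s k) = card (\<Union>j\<le>k. ?P j)"
    by (simp add: bij_betw_same_card)
  also have "\<dots> = (\<Sum>j\<le>k. card (?P j))"
    by (rule card_UN_disjoint) (auto simp: separated_subsets_def)
  finally show ?thesis by (simp add: card_cartesian_product)
qed

text \<open>The size condition for \<open>k\<close> implies it for all \<open>j \<le> k\<close>, so
  every factor of the sum is a Rothe polynomial and the convolution applies. Starting from no
  circles is possible by the values at 0.\<close>

lemma card_separated_subsets:
  assumes "\<And>i. i \<in> {1..p} \<Longrightarrow> s * k + 1 \<le> n i"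
  shows "real (card (separated_subsets p n s k)) = rothe s k (real (\<Sum>i=1..p. n i))"
  using assms
proof (induction p arbitrary: k)
  case 0
  have "separated_subsets 0 n s k = (if k = 0 then {{}} else {})"
    by (auto simp: separated_subsets_def circles_def separated_def)
  then show ?case by (simp add: rothe_at_0)
next
  case (Suc p)
  let ?N = "\<Sum>i=1..p. n i"
  have "real (card (separated_subsets (Suc p) n s k)) =
      (\<Sum>j\<le>k. real (card (separated_subsets p n s j)) * real (card (circle_sets s (n (Suc p)) (k - j))))"
    by (simp add: card_separated_subsets_Suc)
  also have "\<dots> = (\<Sum>j\<le>k. rothe s j (real ?N) * rothe s (k - j) (real (n (Suc p))))"
  proof (rule sum.cong[OF refl])
    fix j assume j: "j \<in> {..k}"
    have le: "s * j + 1 \<le> n i" if "i \<in> {1..Suc p}" "j \<le> k" for i j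
      using Suc.prems[OF that(1)] mult_le_mono2[OF that(2), of s] by linarith
    have "real (card (separated_subsets p n s j)) = rothe s j (real ?N)"
      using le j by (intro Suc.IH) auto
    moreover have "real (card (circle_sets s (n (Suc p)) (k - j))) =
        rothe s (k - j) (real (n (Suc p)))"
      using le by (intro card_circle_sets) auto
    ultimately show "real (card (separated_subsets p n s j)) *
        real (card (circle_sets s (n (Suc p)) (k - j))) =
        rothe s j (real ?N) * rothe s (k - j) (real (n (Suc p)))" by simp
  qed
  also have "\<dots> = rothe s k (real ?N + real (n (Suc p)))"
    using rothe_convolution[where x = "int ?N"] by (simp del: of_nat_sum)
  finally show ?case by simp
qed

theorem theorem4:
  fixes s k p N :: nat and n :: "nat \<Rightarrow> nat"
  assumes "s \<ge> 1" and "k \<ge> 1" and "p \<ge> 1"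
    and "\<And>i. i \<in> {1..p} \<Longrightarrow> n i \<ge> s * k + 1"
    and "N = (\<Sum>i=1..p. n i)"
  shows "real (card (separated_subsets p n s k)) =
           real N / real k * real ((N - s * k - 1) choose (k - 1))"
proof -
  \<comment> \<open>A single circle already forces \<open>s * k + 1 \<le> N\<close>, so the
    natural-number subtraction in the goal is exact and agrees with the real one in
    \<open>rothe\<close>.\<close>
  have "s * k + 1 \<le> n 1" using assms(3,4) by simp
  also have "\<dots> \<le> N"
    unfolding assms(5) using assms(3) by (intro member_le_sum) auto
  finally have "real (N - s * k - 1) = real N - real (s * k) - 1"
    by (simp add: of_nat_diff)
  then show ?thesis
    using card_separated_subsets[of p s k n, OF assms(4)] assms(2)
    unfolding assms(5)[symmetric] by (simp add: rothe_def binomial_gbinomial)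
qed

end
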